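(* Let $j \geq 2$ and $k \geq 1$ be integers and let $N = j^{k+1}$. Then the set $\{1, 2, \ldots, N\}$ of the first $N$ consecutive positive integers can be separated, in at least $\{(j-1)!\}^{k-1}$ ways, into $j$ sets $A_1, \ldots, A_j$, each consisting of $j^k$ integers, such that $$\sum_{a \in A_1} a^r = \sum_{a \in A_2} a^r = \cdots = \sum_{a \in A_j} a^r \quad \text{for every } r = 1, 2, \ldots, k.$$
   Context: To separate $\{1,\ldots,N\}$ into $j$ sets means to partition it into $j$ pairwise disjoint sets whose union is $\{1,\ldots,N\}$. Different "ways" are different partitions, a partition being regarded as an unordered collection of $j$ sets (permuting the labels of $A_1,\ldots,A_j$ does not give a new way). *)

theory Defs
  imports Complex_Main "HOL-Library.Disjoint_Sets"
begin

end

theory Submission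
  imports Defs "HOL-Combinatorics.Permutations"
begin

text \<open>
  The integers \<open>0, \<dots>, j ^ (k + 1) - 1\<close> have \<open>k + 1\<close> base-\<open>j\<close> digits.  Choose for each
  position \<open>i\<close> a permutation \<open>s i\<close> of the digits, and colour \<open>n\<close> by the sum modulo \<open>j\<close> of its
  permuted digits.  The power \<open>n ^ r\<close> is a polynomial in the digits, each of whose monomials
  involves at most \<open>r\<close> positions.  If \<open>r \<le> k\<close>, then some position is absent from the monomial,
  and varying the digit there moves the number through all colours without changing the monomial;
  so every monomial, and hence \<open>n ^ r\<close>, has the same sum over every colour class.  The lemma
  \<open>colour_class_power_sum_eq\<close> carries this out by induction on the number of digits, peeling off
  the leading digit with the binomial theorem.  Shifting everything by one keeps these equalities,
  again by the binomial theorem, and the case \<open>r = 0\<close> shows that the classes have equal size.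

  For the count, take \<open>s 0\<close> to be the identity and let every other \<open>s i\<close> fix the digit \<open>0\<close>.  Then
  \<open>e < j\<close> has colour \<open>e\<close>, whereas \<open>d * j ^ i\<close> has colour \<open>s i d\<close>; so \<open>s i d\<close> is the unique one-digit
  number in the same class as \<open>d * j ^ i\<close>, and the unlabelled partition determines \<open>s\<close>.  This gives
  \<open>((j - 1)!) ^ k\<close> distinct partitions, at least as many as required.
\<close>

section \<open>Colouring integers by their permuted digits\<close>

text \<open>The recursion splits off the leading one of \<open>Suc m\<close> digits, which is the step needed for
  inductions on the number of digits.\<close>

primrec digit_colour :: "nat \<Rightarrow> (nat \<Rightarrow> nat \<Rightarrow> nat) \<Rightarrow> nat \<Rightarrow> nat \<Rightarrow> nat" where
  "digit_colour j s 0 n = 0"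
| "digit_colour j s (Suc m) n = (digit_colour j s m (n mod j ^ m) + s m (n div j ^ m)) mod j"

definition colour_class :: "nat \<Rightarrow> (nat \<Rightarrow> nat \<Rightarrow> nat) \<Rightarrow> nat \<Rightarrow> nat \<Rightarrow> nat set" where
  "colour_class j s m c = {n \<in> {..<j ^ m}. digit_colour j s m n = c}"

lemma finite_colour_class [simp]: "finite (colour_class j s m c)"
  by (simp add: colour_class_def)

lemma digit_colour_less: "0 < j \<Longrightarrow> digit_colour j s m n < j"
  by (cases m) auto

lemma digit_colour_zero:
  assumes "\<And>i. i < m \<Longrightarrow> s i 0 = 0"
  shows "digit_colour j s m 0 = 0"
  using assms by (induction m) auto

lemma digit_colour_single_digit:
  assumes "\<And>i. i < m \<Longrightarrow> s i 0 = 0" and "i < m" and "d < j" and "s i d < j"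
  shows "digit_colour j s m (d * j ^ i) = s i d"
  using assms
proof (induction m)
  case 0
  then show ?case by simp
next
  case (Suc m)
  show ?case
  proof (cases "i = m")
    case True
    then show ?thesis using Suc.prems by (simp add: digit_colour_zero)
  next
    case False
    with Suc.prems have im: "i < m" by simp
    have "d * j ^ i < j ^ Suc i"
      using Suc.prems by simp
    also have "\<dots> \<le> j ^ m"
      using im Suc.prems by (intro power_increasing) auto
    finally have "d * j ^ i < j ^ m" .
    then show ?thesis
      using Suc im by simp
  qed
qed

section \<open>Equal power sums\<close>

text \<open>For a leading digit \<open>d\<close>, the remaining digits must have colour \<open>c\<close> minus \<open>s m d\<close> modulo \<open>j\<close>;
  adding \<open>j\<close> first keeps the subtraction within the natural numbers.\<close>

lemma add_mod_eq_iff: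
  fixes x a c j :: nat
  assumes "x < j" "a < j" "c < j"
  shows "(x + a) mod j = c \<longleftrightarrow> x = (c + (j - a)) mod j"
proof -
  have "(x + a) mod j = (if x + a < j then x + a else x + a - j)"
    using assms by (auto simp: mod_if)
  moreover have "(c + (j - a)) mod j = (if c < a then c + (j - a) else c - a)"
    using assms by (auto simp: mod_if)
  ultimately show ?thesis using assms by auto
qed

lemma colour_class_sum_Suc:
  fixes f :: "nat \<Rightarrow> nat"
  assumes "c < j" and "\<And>d. d < j \<Longrightarrow> s m d < j"
  shows "(\<Sum>n\<in>colour_class j s (Suc m) c. f n)
       = (\<Sum>d<j. \<Sum>x\<in>colour_class j s m ((c + (j - s m d)) mod j). f (x + d * j ^ m))"
proof -
  let ?g = "\<lambda>n. if digit_colour j s (Suc m) n = c then f n else 0"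
  have "(\<Sum>n\<in>colour_class j s (Suc m) c. f n) = (\<Sum>n<j * j ^ m. ?g n)"
    by (simp only: colour_class_def sum.inter_filter finite_lessThan power_Suc)
  also have "\<dots> = (\<Sum>d<j. \<Sum>n = d * j ^ m..<d * j ^ m + j ^ m. ?g n)"
    by (rule sum.nat_group [symmetric])
  also have "\<dots> = (\<Sum>d<j. \<Sum>x<j ^ m. ?g (x + d * j ^ m))"
  proof -
    have "(\<Sum>n = a..<a + b. g n) = (\<Sum>x<b. g (x + a))" for g :: "nat \<Rightarrow> nat" and a b
      using sum.shift_bounds_nat_ivl [of g 0 a b] by (simp add: atLeast0LessThan add.commute)
    then show ?thesis by simp
  qed
  also have "\<dots> = (\<Sum>d<j. \<Sum>x\<in>colour_class j s m ((c + (j - s m d)) mod j). f (x + d * j ^ m))"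
  proof (rule sum.cong [OF refl])
    fix d assume d: "d \<in> {..<j}"
    have "?g (x + d * j ^ m)
        = (if digit_colour j s m x = (c + (j - s m d)) mod j then f (x + d * j ^ m) else 0)"
      if "x < j ^ m" for x
    proof -
      have "digit_colour j s (Suc m) (x + d * j ^ m) = (digit_colour j s m x + s m d) mod j"
        using that assms(1) by (auto simp: div_add1_eq)
      also have "\<dots> = c \<longleftrightarrow> digit_colour j s m x = (c + (j - s m d)) mod j"
        using assms d by (intro add_mod_eq_iff digit_colour_less) auto
      finally show ?thesis by (simp only:)
    qed
    then show "(\<Sum>x<j ^ m. ?g (x + d * j ^ m))
        = (\<Sum>x\<in>colour_class j s m ((c + (j - s m d)) mod j). f (x + d * j ^ m))"
      by (simp only: colour_class_def sum.inter_filter finite_lessThan) (rule sum.cong, auto)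
  qed
  finally show ?thesis .
qed

lemma bij_betw_complementary_colour:
  assumes "bij_betw p {..<j} {..<j}" and "c < j"
  shows "bij_betw (\<lambda>d. (c + (j - p d)) mod j) {..<j} {..<j :: nat}"
proof -
  have "inj_on (\<lambda>x. (c + (j - x)) mod j) {..<j}"
  proof (rule inj_onI)
    fix x y assume *: "x \<in> {..<j}" "y \<in> {..<j}" "(c + (j - x)) mod j = (c + (j - y)) mod j"
    let ?z = "(c + (j - x)) mod j"
    have "?z < j" using assms by simp
    then have "(?z + x) mod j = c" "(?z + y) mod j = c"
      using * assms add_mod_eq_iff [of ?z j x c] add_mod_eq_iff [of ?z j y c] by auto
    then have "x = (c + (j - ?z)) mod j" "y = (c + (j - ?z)) mod j"
      using * assms \<open>?z < j\<close> add_mod_eq_iff [of x j ?z c] add_mod_eq_iff [of y j ?z c]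
      by (simp_all add: add.commute)
    then show "x = y" by simp
  qed
  then have "bij_betw (\<lambda>x. (c + (j - x)) mod j) {..<j} {..<j}"
    unfolding bij_betw_def using assms(2) by (intro conjI endo_inj_surj) auto
  then have "bij_betw ((\<lambda>x. (c + (j - x)) mod j) \<circ> p) {..<j} {..<j}"
    using assms(1) by (rule bij_betw_trans [rotated])
  then show ?thesis by (simp add: o_def)
qed

text \<open>Expand \<open>(x + d * j ^ m) ^ r\<close> by the binomial theorem, where \<open>d\<close> is the leading digit.  The
  terms with \<open>x ^ l\<close> for \<open>l < m\<close> are covered by the induction hypothesis.  The only other term
  occurs for \<open>l = r = m\<close>; it does not contain \<open>d\<close>, so letting \<open>d\<close> range over all digits makes \<open>x\<close>
  range over all colours.\<close>

lemma colour_class_power_sum_eq: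
  assumes "\<And>i. i < m \<Longrightarrow> bij_betw (s i) {..<j} {..<j}" and "r < m" and "c < j" and "c' < j"
  shows "(\<Sum>n\<in>colour_class j s m c. n ^ r) = (\<Sum>n\<in>colour_class j s m c'. n ^ r)"
  using assms
proof (induction m arbitrary: r c c')
  case 0
  then show ?case by simp
next
  case (Suc m)
  define S where "S l e = (\<Sum>x\<in>colour_class j s m e. x ^ l)" for l e
  define \<rho> where "\<rho> e d = (e + (j - s m d)) mod j" for e d
  have bij: "bij_betw (s m) {..<j} {..<j}"
    using Suc.prems by simp
  have \<rho>_less: "\<rho> e d < j" if "e < j" for e d
    using that by (simp add: \<rho>_def)
  have expand: "(\<Sum>n\<in>colour_class j s (Suc m) e. n ^ r)
      = (\<Sum>l\<le>r. (r choose l) * (\<Sum>d<j. (d * j ^ m) ^ (r - l) * S l (\<rho> e d)))" if "e < j" for e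
  proof -
    have "(\<Sum>n\<in>colour_class j s (Suc m) e. n ^ r)
        = (\<Sum>d<j. \<Sum>x\<in>colour_class j s m (\<rho> e d). (x + d * j ^ m) ^ r)"
      unfolding \<rho>_def using bij that by (intro colour_class_sum_Suc) (auto simp: bij_betw_def)
    also have "\<dots> = (\<Sum>d<j. \<Sum>l\<le>r. \<Sum>x\<in>colour_class j s m (\<rho> e d).
                      (r choose l) * x ^ l * (d * j ^ m) ^ (r - l))"
      unfolding binomial by (rule sum.cong [OF refl], subst sum.swap) simp
    also have "\<dots> = (\<Sum>l\<le>r. \<Sum>d<j. \<Sum>x\<in>colour_class j s m (\<rho> e d).
                      (r choose l) * x ^ l * (d * j ^ m) ^ (r - l))"
      by (rule sum.swap)
    finally show ?thesis
      unfolding S_def sum_distrib_left by (simp only: mult_ac)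
  qed
  have "(\<Sum>d<j. (d * j ^ m) ^ (r - l) * S l (\<rho> c d))
      = (\<Sum>d<j. (d * j ^ m) ^ (r - l) * S l (\<rho> c' d))" if "l \<le> r" for l
  proof (cases "l < m")
    case True
    have "S l (\<rho> c d) = S l (\<rho> c' d)" for d
      unfolding S_def using Suc.prems True \<rho>_less by (intro Suc.IH) auto
    then show ?thesis by simp
  next
    case False
    with that Suc.prems have "l = m" "r = m" by auto
    moreover have "(\<Sum>d<j. S m (\<rho> e d)) = (\<Sum>e'<j. S m e')" if "e < j" for e
      unfolding \<rho>_def
      by (rule sum.reindex_bij_betw [OF bij_betw_complementary_colour [OF bij that]])
    ultimately show ?thesis using Suc.prems by simp
  qed
  then show ?case
    using Suc.prems by (simp add: expand)
qed

lemma card_colour_class: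
  assumes "\<And>i. i < Suc k \<Longrightarrow> bij_betw (s i) {..<j} {..<j}" and "c < j"
  shows "card (colour_class j s (Suc k) c) = j ^ k"
proof -
  have eq: "card (colour_class j s (Suc k) e) = card (colour_class j s (Suc k) c)" if "e < j" for e
    using colour_class_power_sum_eq [of "Suc k" s j 0 e c] assms that by simp
  have "{..<j ^ Suc k} = (\<Union>e<j. colour_class j s (Suc k) e)"
    using assms(2) digit_colour_less [of j s "Suc k"] by (auto simp: colour_class_def)
  then have "j ^ Suc k = card (\<Union>e<j. colour_class j s (Suc k) e)"
    by (metis card_lessThan)
  also have "\<dots> = (\<Sum>e<j. card (colour_class j s (Suc k) e))"
    by (rule card_UN_disjoint) (auto simp: colour_class_def)
  also have "\<dots> = j * card (colour_class j s (Suc k) c)"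
    using eq by simp
  finally show ?thesis using assms(2) by simp
qed

section \<open>The partitions of an initial segment of the positive integers\<close>

definition colour_partition :: "nat \<Rightarrow> (nat \<Rightarrow> nat \<Rightarrow> nat) \<Rightarrow> nat \<Rightarrow> nat set set" where
  "colour_partition j s m = (\<lambda>c. Suc ` colour_class j s m c) ` {..<j}"

lemma colour_partition_power_sum_eq:
  assumes "\<And>i. i < m \<Longrightarrow> bij_betw (s i) {..<j} {..<j}" and "r < m"
    and "A \<in> colour_partition j s m" and "B \<in> colour_partition j s m"
  shows "(\<Sum>a\<in>A. a ^ r) = (\<Sum>b\<in>B. b ^ r)"
proof -
  have expand: "(\<Sum>a\<in>Suc ` C. a ^ r) = (\<Sum>l\<le>r. (r choose l) * (\<Sum>n\<in>C. n ^ l))" for C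
  proof -
    have "(\<Sum>a\<in>Suc ` C. a ^ r) = (\<Sum>n\<in>C. (n + 1) ^ r)"
      by (simp add: sum.reindex)
    also have "\<dots> = (\<Sum>l\<le>r. \<Sum>n\<in>C. (r choose l) * n ^ l)"
      unfolding binomial by (subst sum.swap) simp
    finally show ?thesis by (simp add: sum_distrib_left)
  qed
  obtain c c' where c: "c < j" "c' < j"
    and AB: "A = Suc ` colour_class j s m c" "B = Suc ` colour_class j s m c'"
    using assms(3,4) by (auto simp: colour_partition_def)
  have "(\<Sum>n\<in>colour_class j s m c. n ^ l) = (\<Sum>n\<in>colour_class j s m c'. n ^ l)" if "l \<le> r" for l
    using assms(1,2) c that by (intro colour_class_power_sum_eq) auto
  then show ?thesis by (simp add: AB expand)
qed

lemma card_colour_partition_class: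
  assumes "\<And>i. i < Suc k \<Longrightarrow> bij_betw (s i) {..<j} {..<j}" and "A \<in> colour_partition j s (Suc k)"
  shows "card A = j ^ k"
proof -
  obtain c where "c < j" "A = Suc ` colour_class j s (Suc k) c"
    using assms(2) by (auto simp: colour_partition_def)
  then show ?thesis
    using card_colour_class [OF assms(1)] by (simp add: card_image)
qed

lemma partition_on_colour_partition:
  assumes "\<And>i. i < Suc k \<Longrightarrow> bij_betw (s i) {..<j} {..<j}" and "0 < j"
  shows "partition_on {1..j ^ Suc k} (colour_partition j s (Suc k))"
proof (rule partition_onI)
  show "\<Union> (colour_partition j s (Suc k)) = {1..j ^ Suc k}"
  proof -
    have "\<Union> (colour_partition j s (Suc k)) = Suc ` {..<j ^ Suc k}"
      using assms(2) digit_colour_less [of j s "Suc k"]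
      by (fastforce simp: colour_partition_def colour_class_def simp del: power_Suc digit_colour.simps)
    then show ?thesis by (simp add: image_Suc_lessThan)
  qed
next
  have "card A = j ^ k" if "A \<in> colour_partition j s (Suc k)" for A
    using assms(1) that by (rule card_colour_partition_class)
  then show "{} \<notin> colour_partition j s (Suc k)"
    using assms(2) by fastforce
next
  fix A B assume "A \<in> colour_partition j s (Suc k)" "B \<in> colour_partition j s (Suc k)" "A \<noteq> B"
  then show "disjnt A B"
    by (auto simp: colour_partition_def colour_class_def disjnt_def)
qed

lemma card_colour_partition:
  assumes "\<And>i. i < Suc k \<Longrightarrow> bij_betw (s i) {..<j} {..<j}" and "0 < j"
  shows "card (colour_partition j s (Suc k)) = j"
proof -
  have "inj_on (\<lambda>c. Suc ` colour_class j s (Suc k) c) {..<j}"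
  proof (rule inj_onI)
    fix c c' assume c: "c \<in> {..<j}" "c' \<in> {..<j}"
      and eq: "Suc ` colour_class j s (Suc k) c = Suc ` colour_class j s (Suc k) c'"
    have "card (colour_class j s (Suc k) c) = j ^ k"
      using assms(1) c by (intro card_colour_class) auto
    then have "colour_class j s (Suc k) c \<noteq> {}"
      using assms(2) by auto
    moreover have "colour_class j s (Suc k) c = colour_class j s (Suc k) c'"
      using eq by (simp add: inj_image_eq_iff)
    ultimately show "c = c'"
      by (auto simp: colour_class_def)
  qed
  then show ?thesis
    by (simp add: colour_partition_def card_image)
qed

lemma same_colour_if_colour_partition_eq:
  assumes "colour_partition j s m = colour_partition j t m" and "0 < j"
    and "n < j ^ m" and "n' < j ^ m" and "digit_colour j s m n = digit_colour j s m n'"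
  shows "digit_colour j t m n = digit_colour j t m n'"
proof -
  let ?A = "Suc ` colour_class j s m (digit_colour j s m n)"
  have "?A \<in> colour_partition j t m"
    unfolding assms(1) [symmetric] using assms(2)
    by (auto simp: colour_partition_def digit_colour_less)
  then obtain c where "?A = Suc ` colour_class j t m c"
    by (auto simp: colour_partition_def)
  then have "colour_class j s m (digit_colour j s m n) = colour_class j t m c"
    by (simp add: inj_image_eq_iff)
  moreover have "n \<in> colour_class j s m (digit_colour j s m n)"
    "n' \<in> colour_class j s m (digit_colour j s m n)"
    using assms by (auto simp: colour_class_def)
  ultimately show ?thesis by (auto simp: colour_class_def)
qed

section \<open>Counting the partitions\<close>

text \<open>Adding a constant to a digit permutation, or applying one automorphism of the integers
  modulo \<open>j\<close> to all of them, merely relabels the colours.  Fixing the digit \<open>0\<close> and leaving the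
  units digit alone removes this ambiguity.\<close>

definition normalised_perms :: "nat \<Rightarrow> nat \<Rightarrow> (nat \<Rightarrow> nat \<Rightarrow> nat) set" where
  "normalised_perms j k = (\<Pi>\<^sub>E i\<in>{..k}. if i = 0 then {id} else {p. p permutes {1..<j}})"

lemma card_normalised_perms: "card (normalised_perms j k) = fact (j - 1) ^ k"
proof -
  have "card (normalised_perms j k)
      = (\<Prod>i\<le>k. if i = 0 then 1 else fact (j - 1))"
    unfolding normalised_perms_def
    by (subst card_PiE) (auto intro!: prod.cong simp: card_permutations)
  also have "\<dots> = fact (j - 1) ^ k"
    by (simp add: prod.atMost_shift)
  finally show ?thesis .
qed

lemma normalised_perms_permutes:
  assumes "s \<in> normalised_perms j k" and "i \<le> k"
  shows "s i permutes {1..<j}"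
proof -
  have "s i \<in> (if i = 0 then {id} else {p. p permutes {1..<j}})"
    using PiE_mem [OF assms(1) [unfolded normalised_perms_def]] assms(2) by simp
  then show ?thesis by (auto simp: permutes_id split: if_splits)
qed

lemma normalised_perms_units: "s \<in> normalised_perms j k \<Longrightarrow> s 0 = id"
  by (force simp: normalised_perms_def PiE_iff)

lemma normalised_perms_zero: "s \<in> normalised_perms j k \<Longrightarrow> i \<le> k \<Longrightarrow> s i 0 = 0"
  by (rule permutes_not_in [OF normalised_perms_permutes]) auto

lemma normalised_perms_bij:
  assumes "s \<in> normalised_perms j k" and "i \<le> k"
  shows "bij_betw (s i) {..<j} {..<j}"
proof -
  have "s i permutes {..<j}"
    using normalised_perms_permutes [OF assms] by (rule permutes_subset) auto
  then show ?thesis by (rule permutes_imp_bij)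
qed

text \<open>The digit \<open>s i d\<close> is itself a one-digit number with the same colour as \<open>d * j ^ i\<close>.  This
  coincidence is visible in the unlabelled partition, so it also holds for the colouring
  given by \<open>t\<close>, where it says that \<open>s i d = t i d\<close>.\<close>

lemma inj_on_colour_partition:
  assumes "0 < j"
  shows "inj_on (\<lambda>s. colour_partition j s (Suc k)) (normalised_perms j k)"
proof (rule inj_onI)
  fix s t assume s: "s \<in> normalised_perms j k" and t: "t \<in> normalised_perms j k"
    and eq: "colour_partition j s (Suc k) = colour_partition j t (Suc k)"
  have digit_less: "u i d < j" if "u \<in> normalised_perms j k" "i \<le> k" "d < j" for u i d
    using normalised_perms_bij [OF that(1,2)] that(3) by (auto simp: bij_betw_def)
  have colour: "digit_colour j u (Suc k) (d * j ^ i) = u i d"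
    if "u \<in> normalised_perms j k" "i \<le> k" "d < j" for u i d
    using that digit_less [OF that] normalised_perms_zero [OF that(1)]
    by (intro digit_colour_single_digit) auto
  have colour_units: "digit_colour j u (Suc k) e = e"
    if "u \<in> normalised_perms j k" "e < j" for u e
    using colour [OF that(1) le0 that(2)] normalised_perms_units [OF that(1)]
    by (simp del: digit_colour.simps)
  have bound: "d * j ^ i < j ^ Suc k" if "i \<le> k" "d < j" for i d
  proof -
    have "d * j ^ i < j * j ^ i" using that by simp
    also have "\<dots> \<le> j * j ^ k" using that by (intro mult_left_mono power_increasing) auto
    finally show ?thesis by simp
  qed
  have "s i d = t i d" if i: "i \<le> k" and d: "d < j" for i d
  proof -
    have e: "s i d < j" using digit_less [OF s i d] .
    have "digit_colour j t (Suc k) (d * j ^ i) = digit_colour j t (Suc k) (s i d)"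
    proof (rule same_colour_if_colour_partition_eq [OF eq assms])
      show "d * j ^ i < j ^ Suc k" using bound [OF i d] .
      show "s i d < j ^ Suc k" using bound [OF le0 e] by simp
      show "digit_colour j s (Suc k) (d * j ^ i) = digit_colour j s (Suc k) (s i d)"
        using colour [OF s i d] colour_units [OF s e] by simp
    qed
    then show ?thesis
      using colour [OF t i d] colour_units [OF t e] by simp
  qed
  moreover have "s i d = t i d" if "i \<le> k" "\<not> d < j" for i d
    using normalised_perms_permutes [OF s that(1)] normalised_perms_permutes [OF t that(1)] that(2)
    by (simp add: permutes_not_in)
  ultimately have "s i = t i" if "i \<le> k" for i
    using that by blast
  then show "s = t"
    using s t unfolding normalised_perms_def by (intro PiE_ext) auto
qed

theorem theorem8:
  fixes j k N :: nat
  assumes "j \<ge> 2" and "k \<ge> 1" and "N = j ^ (k + 1)"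
  shows "card {P :: nat set set.
            partition_on {1..N} P \<and> card P = j \<and> (\<forall>A\<in>P. card A = j ^ k) \<and>
            (\<forall>r\<in>{1..k}. \<forall>A\<in>P. \<forall>B\<in>P. (\<Sum>a\<in>A. a ^ r) = (\<Sum>a\<in>B. a ^ r))}
         \<ge> (fact (j - 1)) ^ (k - 1)"
    (is "card ?Q \<ge> _")
proof -
  have j: "0 < j" and N: "N = j ^ Suc k"
    using assms by auto
  have "(fact (j - 1) :: nat) ^ (k - 1) \<le> fact (j - 1) ^ k"
    by (intro power_increasing) auto
  also have "\<dots> = card ((\<lambda>s. colour_partition j s (Suc k)) ` normalised_perms j k)"
    by (simp only: card_image [OF inj_on_colour_partition [OF j]] card_normalised_perms)
  also have "\<dots> \<le> card ?Q"
  proof (rule card_mono)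
    have "?Q \<subseteq> {P. partition_on {1..N} P}" by blast
    then show "finite ?Q"
      by (rule finite_subset) (simp add: finitely_many_partition_on)
    show "(\<lambda>s. colour_partition j s (Suc k)) ` normalised_perms j k \<subseteq> ?Q"
    proof (rule image_subsetI)
      fix s assume "s \<in> normalised_perms j k"
      then have bij: "\<And>i. i < Suc k \<Longrightarrow> bij_betw (s i) {..<j} {..<j}"
        by (simp add: normalised_perms_bij)
      have "(\<Sum>a\<in>A. a ^ r) = (\<Sum>a\<in>B. a ^ r)"
        if "r \<in> {1..k}" "A \<in> colour_partition j s (Suc k)" "B \<in> colour_partition j s (Suc k)"
        for r A B
        using bij _ that(2,3) by (rule colour_partition_power_sum_eq) (use that(1) in auto)
      moreover have "card A = j ^ k" if "A \<in> colour_partition j s (Suc k)" for A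
        using bij that by (rule card_colour_partition_class)
      moreover have "partition_on {1..N} (colour_partition j s (Suc k))"
        unfolding N using bij j by (rule partition_on_colour_partition)
      moreover have "card (colour_partition j s (Suc k)) = j"
        using bij j by (rule card_colour_partition)
      ultimately show "colour_partition j s (Suc k) \<in> ?Q"
        by blast
    qed
  qed
  finally show ?thesis .
qed

end
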